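(* (Blame-Subtyping Theorem for EDA$'$.) Let $M:\Gamma\vdash' A$ be a term of EDA$'$ and $\ell$ a blame label. If $M$ is safe for $\ell$, then it is not the case that $M\longrightarrow^{*}\mathtt{blame}\,\ell$.
   Context: EDA$'$ is a cast calculus with partially-eager "D" casts in which cross casts are active. **Types.** Base types $b$: $\mathtt{Nat},\mathtt{Bool},\mathtt{Int},\mathtt{Unit},\bot$. Types: $A,B::=b\mid\,?\mid A\to B\mid A\times B\mid A+B$; atomic types $a::=b\mid\,?$; $\otimes$ ranges over $\{\to,\times,+\}$. Contexts are finite sequences of types; variables are de Bruijn indices (index $0$ is the last-added type). Primitive types $P::=b\mid b\to P$; each $b$ denotes a set (naturals, Booleans, integers, one-element set, empty set), $[\![b\to P]\!]$ is the set of functions $[\![b]\!]\to[\![P]\!]$. Blame labels range over a fixed set. *Consistency* $\sim$: $A\sim\,?$; $?\sim B$; $b\sim b$; $A\otimes B\sim A'\otimes B'$ if $A\sim A'$, $B\sim B'$. **Casts**: $c=(A\Rightarrow^\ell B)$ with $A\sim B$, a cast from $A$ to $B$. *Inert*: $A\Rightarrow^\ell\,?$ with $A\neq\,?$. *Active*: $a\Rightarrow^\ell a$; $?\Rightarrow^\ell B$ with $B\neq\,?$; $A\otimes B\Rightarrow^\ell C\otimes D$. **Terms** (intrinsically typed; $M:\Gamma\vdash' A$): $\$k:P$ for $k\in[\![P]\!]$; $`x:A$ if $x$ has type $A$ in $\Gamma$; $\lambda M:A\to B$ if $M:\Gamma\cdot A\vdash' B$; $L\,M:B$ if $L:A\to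 B$, $M:A$; $\mathtt{if}\,L\,M\,N:B$ if $L:\mathtt{Bool}$, $M,N:B$; $\mathtt{cons}\,M\,N:A\times B$; $\pi_iM:A_i$ if $M:A_1\times A_2$; $\mathtt{inl}[B]M:A+B$ if $M:A$; $\mathtt{inr}[A]M:A+B$ if $M:B$; $\mathtt{case}\,L\,M\,N:B$ if $L:\Gamma\vdash' A_1+A_2$, $M:\Gamma\cdot A_1\vdash' B$, $N:\Gamma\cdot A_2\vdash' B$; $M\langle c\rangle:B$ if $M:A$ and $c$ is a cast from $A$ to $B$; $M\langle\!\langle c\rangle\!\rangle:B$ likewise with $c$ inert; $\mathtt{blame}\,\ell:A$ for every $A$. **Values** $V,W$: $\lambda M$; $\$k$; $\mathtt{cons}\,V\,W$; $\mathtt{inl}[B]V$; $\mathtt{inr}[A]V$; $V\langle\!\langle c\rangle\!\rangle$. **Frames** $F$: $\Box\,M$; $V\,\Box$; $\mathtt{if}\,\Box\,M\,N$; $\mathtt{cons}\,V\,\Box$; $\mathtt{cons}\,\Box\,N$; $\pi_i\Box$; $\mathtt{inl}[B]\Box$; $\mathtt{inr}[A]\Box$; $\mathtt{case}\,\Box\,M\,N$; $\Box\langle c\rangle$; $\Box\langle\!\langle c\rangle\!\rangle$. **Reduction** ($M[N]$ is substitution for variable $0$; $\uparrow$ is weakening by one variable): - $F[M]\longrightarrow F[M']$ if $M\longrightarrow M'$; $F[\mathtt{blame}\,\ell]\longrightarrow\mathtt{blame}\,\ell$. - $V\langle c\rangle\longrightarrow V\langle\!\langle c\rangle\!\rangle$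 for $c$ inert. - $V\langle a\Rightarrow^\ell a\rangle\longrightarrow V$. - $V\langle\!\langle A\Rightarrow^{\ell_1}?\rangle\!\rangle\langle?\Rightarrow^{\ell_2}B\rangle\longrightarrow V\langle A\Rightarrow^{\ell_2}B\rangle$ if $A\sim B$, and $\longrightarrow\mathtt{blame}\,\ell_2$ otherwise ($B\ne\,?$). - $V\langle A\to B\Rightarrow^\ell C\to D\rangle\longrightarrow\lambda\big(((\uparrow V)\,(`0\langle C\Rightarrow^\ell A\rangle))\langle B\Rightarrow^\ell D\rangle\big)$. - $V\langle A\times B\Rightarrow^\ell C\times D\rangle\longrightarrow\mathtt{cons}\,((\pi_1V)\langle A\Rightarrow^\ell C\rangle)\,((\pi_2V)\langle B\Rightarrow^\ell D\rangle)$. - $V\langle A+B\Rightarrow^\ell C+D\rangle\longrightarrow\mathtt{case}\,V\,(\mathtt{inl}[D](`0\langle A\Rightarrow^\ell C\rangle))\,(\mathtt{inr}[C](`0\langle B\Rightarrow^\ell D\rangle))$. - $(\lambda M)V\longrightarrow M[V]$; $\mathtt{if}\,\$\mathtt{true}\,M\,N\longrightarrow M$; $\mathtt{if}\,\$\mathtt{false}\,M\,N\longrightarrow N$; $\pi_1(\mathtt{cons}\,V\,W)\longrightarrow V$; $\pi_2(\mathtt{cons}\,V\,W)\longrightarrow W$; $\mathtt{case}(\mathtt{inl}[B]V)\,M\,N\longrightarrow M[V]$; $\mathtt{case}(\mathtt{inr}[A]V)\,M\,N\longrightarrow N[V]$; $\$k\,\$k'\longrightarrow\$(k(k'))$. $\longrightarrow^{*}$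 is the reflexive-transitive closure. **Subtyping** ("D"): $A<:\,?$; $b<:b$; $A\to B<:C\to D$ if $C<:A$ and $B<:D$; $A\times B<:C\times D$ and $A+B<:C+D$ if $A<:C$ and $B<:D$. **Blame safety.** $\mathsf{CastBlameSafe}\,(A\Rightarrow^{\ell'}B)\,\ell$ holds iff $\ell'\neq\ell$ or $A<:B$. $M$ is *safe for* $\ell$ iff every cast $c$ occurring in $M$ (in a subterm $N\langle c\rangle$ or $N\langle\!\langle c\rangle\!\rangle$) satisfies $\mathsf{CastBlameSafe}\,c\,\ell$ and every subterm $\mathtt{blame}\,\ell'$ of $M$ has $\ell'\neq\ell$. *)

theory Defs
  imports "HOL-Library.FuncSet"
begin

section \<open>Types\<close>

datatype base = BNat | BBool | BInt | BUnit | BBot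

datatype ty =
    TBase base
  | Unk  (\<open>\<star>\<close>)
  | TFun ty ty  (infixr \<open>\<^bold>\<rightarrow>\<close> 65)
  | TProd ty ty  (infixr \<open>\<^bold>\<times>\<close> 70)
  | TSum ty ty  (infixr \<open>\<^bold>+\<close> 68)

inductive atomic :: "ty \<Rightarrow> bool" where
  "atomic (TBase b)"
| "atomic \<star>"

inductive consistent :: "ty \<Rightarrow> ty \<Rightarrow> bool"  (infix \<open>\<sim>\<close> 50) where
  "A \<sim> \<star>"
| "\<star> \<sim> B"
| "TBase b \<sim> TBase b"
| "A \<sim> A' \<Longrightarrow> B \<sim> B' \<Longrightarrow> A \<^bold>\<rightarrow> B \<sim> A' \<^bold>\<rightarrow> B'"
| "A \<sim> A' \<Longrightarrow> B \<sim> B' \<Longrightarrow> A \<^bold>\<times> B \<sim> A' \<^bold>\<times> B'"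
| "A \<sim> A' \<Longrightarrow> B \<sim> B' \<Longrightarrow> A \<^bold>+ B \<sim> A' \<^bold>+ B'"

inductive subtype :: "ty \<Rightarrow> ty \<Rightarrow> bool"  (infix \<open><:\<close> 50) where
  "A <: \<star>"
| "TBase b <: TBase b"
| "C <: A \<Longrightarrow> B <: D \<Longrightarrow> A \<^bold>\<rightarrow> B <: C \<^bold>\<rightarrow> D"
| "A <: C \<Longrightarrow> B <: D \<Longrightarrow> A \<^bold>\<times> B <: C \<^bold>\<times> D"
| "A <: C \<Longrightarrow> B <: D \<Longrightarrow> A \<^bold>+ B <: C \<^bold>+ D"

section \<open>Constants\<close>

text \<open>
  The sets denoted by the primitive types live in one common universe of constants.
  A function constant is a function on the denotation of its base domain; outside that
  domain it is pinned to \<open>undefined\<close> (via \<open>\<rightarrow>\<^sub>E\<close>), so that the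
  denotation of a function type is exactly the full set-theoretic function space.
\<close>

datatype prim = PBase base | PFun base prim

datatype bval = VNat nat | VBool bool | VInt int | VUnit

datatype const = KBase bval | KFun "bval \<Rightarrow> const"

fun base_sem :: "base \<Rightarrow> bval set" where
  "base_sem BNat = range VNat"
| "base_sem BBool = range VBool"
| "base_sem BInt = range VInt"
| "base_sem BUnit = {VUnit}"
| "base_sem BBot = {}"

fun prim_sem :: "prim \<Rightarrow> const set" where
  "prim_sem (PBase b) = KBase ` base_sem b"
| "prim_sem (PFun b P) = KFun ` (base_sem b \<rightarrow>\<^sub>E prim_sem P)"

fun prim_ty :: "prim \<Rightarrow> ty" where
  "prim_ty (PBase b) = TBase b"
| "prim_ty (PFun b P) = TBase b \<^bold>\<rightarrow> prim_ty P"

section \<open>Casts and terms\<close>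

text \<open>
  \<open>Cast A l B\<close> is the cast from \<open>A\<close> to \<open>B\<close> with label \<open>l\<close>; the requirement that
  \<open>A\<close> and \<open>B\<close> be consistent is imposed by the typing rules. The type variable \<open>'l\<close>
  is the set of blame labels.
\<close>

datatype 'l cast = Cast (src: ty) (lbl: 'l) (tgt: ty)

definition inert :: "'l cast \<Rightarrow> bool" where
  "inert c \<longleftrightarrow> src c \<noteq> \<star> \<and> tgt c = \<star>"

text \<open>
  Intrinsically typed terms are represented by Church-style terms together with the typing
  judgement below. \<open>Lam\<close>, \<open>Const\<close> and \<open>Blame\<close> carry the type that an intrinsically typed
  term determines implicitly, so that in a given context every term has at most one type and
  at most one typing derivation: the terms of type \<open>A\<close> in \<open>\<Gamma>\<close> are in bijection with
  the \<open>M\<close> such that \<open>\<Gamma> \<turnstile> M \<^bold>: A\<close>.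
\<close>

datatype 'l tm =
    Const prim const
  | Var nat
  | Lam ty "'l tm"
  | App "'l tm" "'l tm"
  | Cond "'l tm" "'l tm" "'l tm"
  | Tuple "'l tm" "'l tm"
  | Fst "'l tm"
  | Snd "'l tm"
  | InL ty "'l tm"
  | InR ty "'l tm"
  | Case "'l tm" "'l tm" "'l tm"
  | CastTm "'l tm" "'l cast"  (\<open>_\<langle>_\<rangle>\<close> [1000, 0] 1000)
  | Wrap "'l tm" "'l cast"  (\<open>_\<llangle>_\<rrangle>\<close> [1000, 0] 1000)
  | Blame ty 'l

text \<open>The head of a context is its last-added type, i.e. the type of variable \<open>0\<close>.\<close>

inductive has_type :: "ty list \<Rightarrow> 'l tm \<Rightarrow> ty \<Rightarrow> bool"  (\<open>_ \<turnstile> _ \<^bold>: _\<close> [50, 50, 50] 50) where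
  ty_const: "k \<in> prim_sem P \<Longrightarrow> \<Gamma> \<turnstile> Const P k \<^bold>: prim_ty P"
| ty_var: "x < length \<Gamma> \<Longrightarrow> \<Gamma> \<turnstile> Var x \<^bold>: \<Gamma> ! x"
| ty_lam: "A # \<Gamma> \<turnstile> M \<^bold>: B \<Longrightarrow> \<Gamma> \<turnstile> Lam A M \<^bold>: A \<^bold>\<rightarrow> B"
| ty_app: "\<Gamma> \<turnstile> L \<^bold>: A \<^bold>\<rightarrow> B \<Longrightarrow> \<Gamma> \<turnstile> M \<^bold>: A \<Longrightarrow> \<Gamma> \<turnstile> App L M \<^bold>: B"
| ty_if: "\<Gamma> \<turnstile> L \<^bold>: TBase BBool \<Longrightarrow> \<Gamma> \<turnstile> M \<^bold>: B \<Longrightarrow> \<Gamma> \<turnstile> N \<^bold>: B \<Longrightarrow> \<Gamma> \<turnstile> Cond L M N \<^bold>: B"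
| ty_pair: "\<Gamma> \<turnstile> M \<^bold>: A \<Longrightarrow> \<Gamma> \<turnstile> N \<^bold>: B \<Longrightarrow> \<Gamma> \<turnstile> Tuple M N \<^bold>: A \<^bold>\<times> B"
| ty_fst: "\<Gamma> \<turnstile> M \<^bold>: A \<^bold>\<times> B \<Longrightarrow> \<Gamma> \<turnstile> Fst M \<^bold>: A"
| ty_snd: "\<Gamma> \<turnstile> M \<^bold>: A \<^bold>\<times> B \<Longrightarrow> \<Gamma> \<turnstile> Snd M \<^bold>: B"
| ty_inl: "\<Gamma> \<turnstile> M \<^bold>: A \<Longrightarrow> \<Gamma> \<turnstile> InL B M \<^bold>: A \<^bold>+ B"
| ty_inr: "\<Gamma> \<turnstile> M \<^bold>: B \<Longrightarrow> \<Gamma> \<turnstile> InR A M \<^bold>: A \<^bold>+ B"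
| ty_case: "\<Gamma> \<turnstile> L \<^bold>: A \<^bold>+ B \<Longrightarrow> A # \<Gamma> \<turnstile> M \<^bold>: C \<Longrightarrow> B # \<Gamma> \<turnstile> N \<^bold>: C \<Longrightarrow> \<Gamma> \<turnstile> Case L M N \<^bold>: C"
| ty_cast: "\<Gamma> \<turnstile> M \<^bold>: A \<Longrightarrow> A \<sim> B \<Longrightarrow> \<Gamma> \<turnstile> M\<langle>Cast A l B\<rangle> \<^bold>: B"
| ty_wrap: "\<Gamma> \<turnstile> M \<^bold>: A \<Longrightarrow> A \<sim> B \<Longrightarrow> inert (Cast A l B) \<Longrightarrow> \<Gamma> \<turnstile> M\<llangle>Cast A l B\<rrangle> \<^bold>: B"
| ty_blame: "\<Gamma> \<turnstile> Blame A l \<^bold>: A"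

section \<open>Renaming and substitution\<close>

definition ext :: "(nat \<Rightarrow> nat) \<Rightarrow> nat \<Rightarrow> nat" where
  "ext \<rho> = case_nat 0 (\<lambda>x. Suc (\<rho> x))"

primrec rename :: "(nat \<Rightarrow> nat) \<Rightarrow> 'l tm \<Rightarrow> 'l tm" where
  "rename \<rho> (Const P k) = Const P k"
| "rename \<rho> (Var x) = Var (\<rho> x)"
| "rename \<rho> (Lam A M) = Lam A (rename (ext \<rho>) M)"
| "rename \<rho> (App L M) = App (rename \<rho> L) (rename \<rho> M)"
| "rename \<rho> (Cond L M N) = Cond (rename \<rho> L) (rename \<rho> M) (rename \<rho> N)"
| "rename \<rho> (Tuple M N) = Tuple (rename \<rho> M) (rename \<rho> N)"
| "rename \<rho> (Fst M) = Fst (rename \<rho> M)"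
| "rename \<rho> (Snd M) = Snd (rename \<rho> M)"
| "rename \<rho> (InL B M) = InL B (rename \<rho> M)"
| "rename \<rho> (InR A M) = InR A (rename \<rho> M)"
| "rename \<rho> (Case L M N) = Case (rename \<rho> L) (rename (ext \<rho>) M) (rename (ext \<rho>) N)"
| "rename \<rho> (M\<langle>c\<rangle>) = (rename \<rho> M)\<langle>c\<rangle>"
| "rename \<rho> (M\<llangle>c\<rrangle>) = (rename \<rho> M)\<llangle>c\<rrangle>"
| "rename \<rho> (Blame A l) = Blame A l"

abbreviation weaken :: "'l tm \<Rightarrow> 'l tm" where
  "weaken \<equiv> rename Suc"

definition exts :: "(nat \<Rightarrow> 'l tm) \<Rightarrow> nat \<Rightarrow> 'l tm" where
  "exts \<sigma> = case_nat (Var 0) (\<lambda>x. weaken (\<sigma> x))"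

primrec subst :: "(nat \<Rightarrow> 'l tm) \<Rightarrow> 'l tm \<Rightarrow> 'l tm" where
  "subst \<sigma> (Const P k) = Const P k"
| "subst \<sigma> (Var x) = \<sigma> x"
| "subst \<sigma> (Lam A M) = Lam A (subst (exts \<sigma>) M)"
| "subst \<sigma> (App L M) = App (subst \<sigma> L) (subst \<sigma> M)"
| "subst \<sigma> (Cond L M N) = Cond (subst \<sigma> L) (subst \<sigma> M) (subst \<sigma> N)"
| "subst \<sigma> (Tuple M N) = Tuple (subst \<sigma> M) (subst \<sigma> N)"
| "subst \<sigma> (Fst M) = Fst (subst \<sigma> M)"
| "subst \<sigma> (Snd M) = Snd (subst \<sigma> M)"
| "subst \<sigma> (InL B M) = InL B (subst \<sigma> M)"
| "subst \<sigma> (InR A M) = InR A (subst \<sigma> M)"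
| "subst \<sigma> (Case L M N) = Case (subst \<sigma> L) (subst (exts \<sigma>) M) (subst (exts \<sigma>) N)"
| "subst \<sigma> (M\<langle>c\<rangle>) = (subst \<sigma> M)\<langle>c\<rangle>"
| "subst \<sigma> (M\<llangle>c\<rrangle>) = (subst \<sigma> M)\<llangle>c\<rrangle>"
| "subst \<sigma> (Blame A l) = Blame A l"

definition subst0 :: "'l tm \<Rightarrow> 'l tm \<Rightarrow> 'l tm"  (\<open>_[_]\<^sub>0\<close> [1000, 0] 1000) where
  "M[N]\<^sub>0 = subst (case_nat N Var) M"

section \<open>Values, frames and reduction\<close>

inductive val :: "'l tm \<Rightarrow> bool" where
  "val (Lam A M)"
| "val (Const P k)"
| "val V \<Longrightarrow> val W \<Longrightarrow> val (Tuple V W)"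
| "val V \<Longrightarrow> val (InL B V)"
| "val V \<Longrightarrow> val (InR A V)"
| "val V \<Longrightarrow> val (V\<llangle>c\<rrangle>)"

datatype 'l frame =
    FAppL "'l tm"
  | FAppR "'l tm"
  | FIf "'l tm" "'l tm"
  | FPairR "'l tm"
  | FPairL "'l tm"
  | FFst
  | FSnd
  | FInl ty
  | FInr ty
  | FCase "'l tm" "'l tm"
  | FCast "'l cast"
  | FWrap "'l cast"

fun plug :: "'l frame \<Rightarrow> 'l tm \<Rightarrow> 'l tm" where
  "plug (FAppL M) X = App X M"
| "plug (FAppR V) X = App V X"
| "plug (FIf M N) X = Cond X M N"
| "plug (FPairR V) X = Tuple V X"
| "plug (FPairL N) X = Tuple X N"
| "plug FFst X = Fst X"
| "plug FSnd X = Snd X"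
| "plug (FInl B) X = InL B X"
| "plug (FInr A) X = InR A X"
| "plug (FCase M N) X = Case X M N"
| "plug (FCast c) X = X\<langle>c\<rangle>"
| "plug (FWrap c) X = X\<llangle>c\<rrangle>"

text \<open>
  \<open>frame_type \<Gamma> F A B\<close>: in context \<open>\<Gamma>\<close>, the frame \<open>F\<close> has a hole of type \<open>A\<close> and
  its result has type \<open>B\<close>. The value restrictions on frames are imposed here.
\<close>

inductive frame_type :: "ty list \<Rightarrow> 'l frame \<Rightarrow> ty \<Rightarrow> ty \<Rightarrow> bool" where
  "\<Gamma> \<turnstile> M \<^bold>: A \<Longrightarrow> frame_type \<Gamma> (FAppL M) (A \<^bold>\<rightarrow> B) B"
| "\<Gamma> \<turnstile> V \<^bold>: A \<^bold>\<rightarrow> B \<Longrightarrow> val V \<Longrightarrow> frame_type \<Gamma> (FAppR V) A B"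
| "\<Gamma> \<turnstile> M \<^bold>: B \<Longrightarrow> \<Gamma> \<turnstile> N \<^bold>: B \<Longrightarrow> frame_type \<Gamma> (FIf M N) (TBase BBool) B"
| "\<Gamma> \<turnstile> V \<^bold>: A \<Longrightarrow> val V \<Longrightarrow> frame_type \<Gamma> (FPairR V) B (A \<^bold>\<times> B)"
| "\<Gamma> \<turnstile> N \<^bold>: B \<Longrightarrow> frame_type \<Gamma> (FPairL N) A (A \<^bold>\<times> B)"
| "frame_type \<Gamma> FFst (A \<^bold>\<times> B) A"
| "frame_type \<Gamma> FSnd (A \<^bold>\<times> B) B"
| "frame_type \<Gamma> (FInl B) A (A \<^bold>+ B)"
| "frame_type \<Gamma> (FInr A) B (A \<^bold>+ B)"
| "A # \<Gamma> \<turnstile> M \<^bold>: C \<Longrightarrow> B # \<Gamma> \<turnstile> N \<^bold>: C \<Longrightarrow> frame_type \<Gamma> (FCase M N) (A \<^bold>+ B) C"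
| "A \<sim> B \<Longrightarrow> frame_type \<Gamma> (FCast (Cast A l B)) A B"
| "A \<sim> B \<Longrightarrow> inert (Cast A l B) \<Longrightarrow> frame_type \<Gamma> (FWrap (Cast A l B)) A B"

text \<open>
  \<open>step \<Gamma> T M M'\<close> is reduction between terms of type \<open>T\<close> in context \<open>\<Gamma>\<close>: the
  premises of every rule ensure that redex and reduct have type \<open>T\<close>.
\<close>

inductive step :: "ty list \<Rightarrow> ty \<Rightarrow> 'l tm \<Rightarrow> 'l tm \<Rightarrow> bool" where
  frame:
    "frame_type \<Gamma> F A T \<Longrightarrow> step \<Gamma> A M M' \<Longrightarrow> step \<Gamma> T (plug F M) (plug F M')"
| frame_blame:
    "frame_type \<Gamma> F A T \<Longrightarrow> step \<Gamma> T (plug F (Blame A l)) (Blame T l)"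
| wrap:
    "\<Gamma> \<turnstile> V\<langle>c\<rangle> \<^bold>: T \<Longrightarrow> val V \<Longrightarrow> inert c \<Longrightarrow> step \<Gamma> T (V\<langle>c\<rangle>) (V\<llangle>c\<rrangle>)"
| cast_atomic:
    "\<Gamma> \<turnstile> V\<langle>Cast A l A\<rangle> \<^bold>: T \<Longrightarrow> val V \<Longrightarrow> atomic A \<Longrightarrow> step \<Gamma> T (V\<langle>Cast A l A\<rangle>) V"
| collapse:
    "\<Gamma> \<turnstile> V\<llangle>Cast A l\<^sub>1 \<star>\<rrangle>\<langle>Cast \<star> l\<^sub>2 B\<rangle> \<^bold>: T \<Longrightarrow> val V \<Longrightarrow> B \<noteq> \<star> \<Longrightarrow> A \<sim> B \<Longrightarrow>
     step \<Gamma> T (V\<llangle>Cast A l\<^sub>1 \<star>\<rrangle>\<langle>Cast \<star> l\<^sub>2 B\<rangle>) (V\<langle>Cast A l\<^sub>2 B\<rangle>)"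
| conflict:
    "\<Gamma> \<turnstile> V\<llangle>Cast A l\<^sub>1 \<star>\<rrangle>\<langle>Cast \<star> l\<^sub>2 B\<rangle> \<^bold>: T \<Longrightarrow> val V \<Longrightarrow> B \<noteq> \<star> \<Longrightarrow> \<not> A \<sim> B \<Longrightarrow>
     step \<Gamma> T (V\<llangle>Cast A l\<^sub>1 \<star>\<rrangle>\<langle>Cast \<star> l\<^sub>2 B\<rangle>) (Blame T l\<^sub>2)"
| cast_fun:
    "\<Gamma> \<turnstile> V\<langle>Cast (A \<^bold>\<rightarrow> B) l (C \<^bold>\<rightarrow> D)\<rangle> \<^bold>: T \<Longrightarrow> val V \<Longrightarrow>
     step \<Gamma> T (V\<langle>Cast (A \<^bold>\<rightarrow> B) l (C \<^bold>\<rightarrow> D)\<rangle>)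
       (Lam C ((App (weaken V) ((Var 0)\<langle>Cast C l A\<rangle>))\<langle>Cast B l D\<rangle>))"
| cast_prod:
    "\<Gamma> \<turnstile> V\<langle>Cast (A \<^bold>\<times> B) l (C \<^bold>\<times> D)\<rangle> \<^bold>: T \<Longrightarrow> val V \<Longrightarrow>
     step \<Gamma> T (V\<langle>Cast (A \<^bold>\<times> B) l (C \<^bold>\<times> D)\<rangle>)
       (Tuple ((Fst V)\<langle>Cast A l C\<rangle>) ((Snd V)\<langle>Cast B l D\<rangle>))"
| cast_sum:
    "\<Gamma> \<turnstile> V\<langle>Cast (A \<^bold>+ B) l (C \<^bold>+ D)\<rangle> \<^bold>: T \<Longrightarrow> val V \<Longrightarrow>
     step \<Gamma> T (V\<langle>Cast (A \<^bold>+ B) l (C \<^bold>+ D)\<rangle>)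
       (Case V (InL D ((Var 0)\<langle>Cast A l C\<rangle>)) (InR C ((Var 0)\<langle>Cast B l D\<rangle>)))"
| beta:
    "\<Gamma> \<turnstile> App (Lam A M) V \<^bold>: T \<Longrightarrow> val V \<Longrightarrow> step \<Gamma> T (App (Lam A M) V) (M[V]\<^sub>0)"
| if_true:
    "\<Gamma> \<turnstile> Cond (Const (PBase BBool) (KBase (VBool True))) M N \<^bold>: T \<Longrightarrow>
     step \<Gamma> T (Cond (Const (PBase BBool) (KBase (VBool True))) M N) M"
| if_false:
    "\<Gamma> \<turnstile> Cond (Const (PBase BBool) (KBase (VBool False))) M N \<^bold>: T \<Longrightarrow>
     step \<Gamma> T (Cond (Const (PBase BBool) (KBase (VBool False))) M N) N"
| fst:
    "\<Gamma> \<turnstile> Fst (Tuple V W) \<^bold>: T \<Longrightarrow> val V \<Longrightarrow> val W \<Longrightarrow> step \<Gamma> T (Fst (Tuple V W)) V"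
| snd:
    "\<Gamma> \<turnstile> Snd (Tuple V W) \<^bold>: T \<Longrightarrow> val V \<Longrightarrow> val W \<Longrightarrow> step \<Gamma> T (Snd (Tuple V W)) W"
| case_inl:
    "\<Gamma> \<turnstile> Case (InL B V) M N \<^bold>: T \<Longrightarrow> val V \<Longrightarrow> step \<Gamma> T (Case (InL B V) M N) (M[V]\<^sub>0)"
| case_inr:
    "\<Gamma> \<turnstile> Case (InR A V) M N \<^bold>: T \<Longrightarrow> val V \<Longrightarrow> step \<Gamma> T (Case (InR A V) M N) (N[V]\<^sub>0)"
| delta:
    "KFun f \<in> prim_sem (PFun b P) \<Longrightarrow> KBase v \<in> prim_sem (PBase b) \<Longrightarrow>
     step \<Gamma> (prim_ty P) (App (Const (PFun b P) (KFun f)) (Const (PBase b) (KBase v))) (Const P (f v))"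

abbreviation steps :: "ty list \<Rightarrow> ty \<Rightarrow> 'l tm \<Rightarrow> 'l tm \<Rightarrow> bool" where
  "steps \<Gamma> T \<equiv> (step \<Gamma> T)\<^sup>*\<^sup>*"

section \<open>Blame safety\<close>

primrec subterms :: "'l tm \<Rightarrow> 'l tm set" where
  "subterms (Const P k) = {Const P k}"
| "subterms (Var x) = {Var x}"
| "subterms (Lam A M) = insert (Lam A M) (subterms M)"
| "subterms (App L M) = insert (App L M) (subterms L \<union> subterms M)"
| "subterms (Cond L M N) = insert (Cond L M N) (subterms L \<union> subterms M \<union> subterms N)"
| "subterms (Tuple M N) = insert (Tuple M N) (subterms M \<union> subterms N)"
| "subterms (Fst M) = insert (Fst M) (subterms M)"
| "subterms (Snd M) = insert (Snd M) (subterms M)"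
| "subterms (InL B M) = insert (InL B M) (subterms M)"
| "subterms (InR A M) = insert (InR A M) (subterms M)"
| "subterms (Case L M N) = insert (Case L M N) (subterms L \<union> subterms M \<union> subterms N)"
| "subterms (M\<langle>c\<rangle>) = insert (M\<langle>c\<rangle>) (subterms M)"
| "subterms (M\<llangle>c\<rrangle>) = insert (M\<llangle>c\<rrangle>) (subterms M)"
| "subterms (Blame A l) = {Blame A l}"

definition cast_blame_safe :: "'l cast \<Rightarrow> 'l \<Rightarrow> bool" where
  "cast_blame_safe c l \<longleftrightarrow> lbl c \<noteq> l \<or> src c <: tgt c"

definition safe_for :: "'l tm \<Rightarrow> 'l \<Rightarrow> bool" where
  "safe_for M l \<longleftrightarrow>
     (\<forall>N c. N\<langle>c\<rangle> \<in> subterms M \<or> N\<llangle>c\<rrangle> \<in> subterms M \<longrightarrow> cast_blame_safe c l) \<and>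
     (\<forall>A l'. Blame A l' \<in> subterms M \<longrightarrow> l' \<noteq> l)"

end

theory Submission
  imports Defs
begin

text \<open>
  Safety for a label is preserved by reduction, and \<open>Blame A l\<close> is not safe for \<open>l\<close>.
  The structural cast rules keep the label and decompose the subtyping derivation. In the two rules
  that meet a projection \<open>Cast \<star> l\<^sub>2 B\<close> with \<open>B \<noteq> \<star>\<close>, no subtyping \<open>\<star> <: B\<close> exists, so safety
  of the projection already forces \<open>l\<^sub>2 \<noteq> l\<close>.
\<close>

text \<open>Turns the quantification over \<open>subterms\<close> into structural recursion; later
  proofs never unfold \<open>safe_for\<close>.\<close>

lemma safe_for_simps [simp]:
  "safe_for (Const P k) l"
  "safe_for (Var x) l"
  "safe_for (Lam A M) l \<longleftrightarrow> safe_for M l"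
  "safe_for (App L M) l \<longleftrightarrow> safe_for L l \<and> safe_for M l"
  "safe_for (Cond L M N) l \<longleftrightarrow> safe_for L l \<and> safe_for M l \<and> safe_for N l"
  "safe_for (Tuple M N) l \<longleftrightarrow> safe_for M l \<and> safe_for N l"
  "safe_for (Fst M) l \<longleftrightarrow> safe_for M l"
  "safe_for (Snd M) l \<longleftrightarrow> safe_for M l"
  "safe_for (InL B M) l \<longleftrightarrow> safe_for M l"
  "safe_for (InR A M) l \<longleftrightarrow> safe_for M l"
  "safe_for (Case L M N) l \<longleftrightarrow> safe_for L l \<and> safe_for M l \<and> safe_for N l"
  "safe_for (M\<langle>c\<rangle>) l \<longleftrightarrow> cast_blame_safe c l \<and> safe_for M l"
  "safe_for (M\<llangle>c\<rrangle>) l \<longleftrightarrow> cast_blame_safe c l \<and> safe_for M l"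
  "safe_for (Blame A l') l \<longleftrightarrow> l' \<noteq> l"
  by (auto simp: safe_for_def)

lemma safe_for_rename [simp]: "safe_for (rename \<rho> M) l \<longleftrightarrow> safe_for M l"
  by (induction M arbitrary: \<rho>) auto

lemma safe_for_exts:
  assumes "\<And>x. safe_for (\<sigma> x) l"
  shows "safe_for (exts \<sigma> x) l"
  using assms by (auto simp: exts_def split: nat.split)

lemma safe_for_subst:
  assumes "safe_for M l" and "\<And>x. safe_for (\<sigma> x) l"
  shows "safe_for (subst \<sigma> M) l"
  using assms by (induction M arbitrary: \<sigma>) (auto simp: safe_for_exts)

lemma safe_for_subst0:
  assumes "safe_for M l" and "safe_for N l"
  shows "safe_for (M[N]\<^sub>0) l"
  using assms by (auto simp: subst0_def intro!: safe_for_subst split: nat.split)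

inductive_simps subtype_Unk_left: "\<star> <: B"
inductive_simps subtype_TFun [simp]: "A \<^bold>\<rightarrow> B <: C \<^bold>\<rightarrow> D"
inductive_simps subtype_TProd [simp]: "A \<^bold>\<times> B <: C \<^bold>\<times> D"
inductive_simps subtype_TSum [simp]: "A \<^bold>+ B <: C \<^bold>+ D"

text \<open>A frame contributes the same casts and \<open>Blame\<close> subterms whatever fills its
  hole. The implication in the second premise matches the induction hypothesis for rule
  \<open>frame\<close>.\<close>

lemma safe_for_plug_cong:
  assumes "safe_for (plug F M) l" and "safe_for M l \<Longrightarrow> safe_for M' l"
  shows "safe_for (plug F M') l"
  using assms by (cases F) auto

lemma safe_for_plugD: "safe_for (plug F M) l \<Longrightarrow> safe_for M l"
  by (cases F) auto

lemma step_safe_for: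
  assumes "step \<Gamma> T M M'" and "safe_for M l"
  shows "safe_for M' l"
  using assms
proof (induction rule: step.induct)
  case frame
  then show ?case by (blast intro: safe_for_plug_cong)
next
  case frame_blame
  \<comment> \<open>Only the type annotation of \<open>Blame\<close> changes, not its label.\<close>
  then show ?case by (auto dest: safe_for_plugD)
\<comment> \<open>In \<open>cast_fun\<close>, contravariance of \<open><:\<close> covers the
  reversed domain cast \<open>Cast C l A\<close>.\<close>
qed (auto simp: cast_blame_safe_def subtype_Unk_left safe_for_subst0)

lemma steps_safe_for:
  assumes "steps \<Gamma> T M M'" and "safe_for M l"
  shows "safe_for M' l"
  using assms by (induction rule: rtranclp_induct) (auto intro: step_safe_for)

theorem corollary31:
  fixes \<Gamma> :: "ty list" and A :: ty and M :: "'l tm" and l :: 'l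
  assumes "\<Gamma> \<turnstile> M \<^bold>: A"
    and "safe_for M l"
  shows "\<not> steps \<Gamma> A M (Blame A l)"
  using steps_safe_for[OF _ assms(2)] by fastforce

end
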